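(* Let $X\subset\mathbb{Q}_p$ be a compact open set and let $f=P/Q:X\to X$ be a rational function that is a local isometry on $X$. Let $t_0$ be the intrinsic level of $f$ (with respect to a fixed admissible $l$ and a fixed choice of representatives), let $t\le t_0$ be an integer, let $K$ be the union of any collection of cycles in the digraph $G(f,p^t)$, and let $Y=\widetilde{K}$ be the union of the balls corresponding to the vertices of $K$. Then $f|_Y:Y\to Y$ is a well-defined invertible local isometry, and in particular $f|_Y$ is measure-preserving.
   Context: $|\cdot|$ is the $p$-adic absolute value, $B_r(a)=\{x\in\mathbb{Q}_p:|x-a|\le r\}$, $\mu$ is Haar measure with $\mu(B_{p^k}(a))=p^k$. A rational function $f:X\to X$ means $f=P/Q$ with $P,Q\in\mathbb{Z}_p[x]$ coprime (fixed), $Q$ without roots in $X$, $f(X)\subset X$. Local isometry: for every $a$ there is $r>0$ with $|f(x)-f(y)|=|x-y|$ for all $x,y\in B_r(a)$ (on compact open $X$ this is equivalent to $|f'(a)|=1$ for all $a\in X$). Invertible: bijective. Measure-preserving: $\mu(f^{-1}(A))=\mu(A)$ for all Borel sets $A$. Admissible $l$: an integer such that for all $a\in X$, $B_{p^l}(a)\subset X$ and $|f(x)-f(y)|=|f'(a)|\,|x-y|$ for all $x,y\in B_{p^l}(a)$. For an integer $t\le l$ write $X=\bigsqcup_{i=1}^m D_{t,i}$ ($m=m(t)$) as a disjoint union of closed balls of radius $p^t$. Digraph $G(f,p^t)$: vertices $A_{t,1},\dots,A_{t,m}$, with an edge $(A_{t,i},A_{t,j})$ iff $f(D_{t,i})\subset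 D_{t,j}$. Each vertex has outdegree $1$; loops count as cycles of length $1$. Representatives: for each $t\le l$ a set $S_t=\{a_{t,1},\dots,a_{t,m}\}$ with $a_{t,i}\in D_{t,i}$, chosen so that $S_l\subset S_{l-1}\subset S_{l-2}\subset\cdots$. Subsidiary digraph $G^{\ast}(f,p^t)$: same vertices as $G(f,p^t)$; $(A_{t,i},A_{t,j})$ is an edge iff $f(D_{t,i})\subset D_{t,j}$ and, with $s$ the least non-negative integer such that $P(p^sx+a_{t,i})-(p^sy+a_{t,j})Q(p^sx+a_{t,i})\in\mathbb{Z}_p[x,y]$, $$p^t<\min\left\{p^{-s},\ p^l|f'(a_{t,i})|,\ \frac{|Q(a_{t,i})|\,|f'(a_{t,i})|}{|Q'(a_{t,i})|},\ p^{-2s}|Q(a_{t,i})|\,|f'(a_{t,i})|^2\right\}.$$ Conventions: the third term is $+\infty$ if $Q'(a_{t,i})=0$; if no such $s$ exists, there is no edge. Intrinsic level $t_0$: the largest integer $t\le l$ with $G(f,p^t)=G^{\ast}(f,p^t)$ (it exists when $f'$ has no root in $X$). *)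

theory Defs
  imports
    "HOL-Analysis.Analysis"
    "HOL-Computational_Algebra.Computational_Algebra"
    "Berlekamp_Zassenhaus.Finite_Field"
    "Graph_Theory.Graph_Theory"
begin

section \<open>The ring of p-adic integers\<close>

text \<open>
  The prime is \<open>p = CARD('p)\<close>, where \<open>'p\<close> is a type of prime cardinality.  The ring of p-adic
  integers is the inverse limit of the rings \<open>\<int>/p\<^sup>n\<close>, with residues represented in
  \<open>{0..<p\<^sup>n}\<close>.
\<close>

typedef (overloaded) ('p::prime_card) padic_int =
  "{x :: nat \<Rightarrow> int. \<forall>n. x n mod int CARD('p) ^ n = x n \<and> x (Suc n) mod int CARD('p) ^ n = x n}"
  by (rule exI[of _ "\<lambda>_. 0"]) simp

setup_lifting type_definition_padic_int

instantiation padic_int :: (prime_card) comm_ring_1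
begin

lift_definition zero_padic_int :: "'a padic_int" is "\<lambda>n. 0" by simp

lift_definition one_padic_int :: "'a padic_int" is "\<lambda>n. 1 mod int CARD('a) ^ n"
  by (simp add: mod_mod_cancel)

lift_definition plus_padic_int :: "'a padic_int \<Rightarrow> 'a padic_int \<Rightarrow> 'a padic_int"
  is "\<lambda>x y n. (x n + y n) mod int CARD('a) ^ n"
  by (simp add: mod_mod_cancel) (metis mod_add_eq)

lift_definition minus_padic_int :: "'a padic_int \<Rightarrow> 'a padic_int \<Rightarrow> 'a padic_int"
  is "\<lambda>x y n. (x n - y n) mod int CARD('a) ^ n"
  by (simp add: mod_mod_cancel) (metis mod_diff_eq)

lift_definition uminus_padic_int :: "'a padic_int \<Rightarrow> 'a padic_int"
  is "\<lambda>x n. (- x n) mod int CARD('a) ^ n"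
  by (simp add: mod_mod_cancel) (metis mod_minus_eq)

lift_definition times_padic_int :: "'a padic_int \<Rightarrow> 'a padic_int \<Rightarrow> 'a padic_int"
  is "\<lambda>x y n. (x n * y n) mod int CARD('a) ^ n"
  by (simp add: mod_mod_cancel) (metis mod_mult_eq)

instance
proof
  fix a b c :: "'a padic_int"
  show "a * b * c = a * (b * c)"
    by transfer (simp add: mod_simps mult.assoc)
  show "a * b = b * a"
    by transfer (simp add: mult.commute)
  show "1 * a = a"
    by transfer (simp add: mod_simps fun_eq_iff)
  show "a + b + c = a + (b + c)"
    by transfer (simp add: mod_simps add.assoc)
  show "a + b = b + a"
    by transfer (simp add: add.commute)
  show "0 + a = a"
    by transfer (simp add: fun_eq_iff)
  show "- a + a = 0"
    by transfer (simp add: mod_simps fun_eq_iff)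
  show "a - b = a + - b"
    by transfer (simp add: mod_simps fun_eq_iff)
  show "(a + b) * c = a * c + b * c"
    by transfer (simp add: mod_simps distrib_right)
  show "(0 :: 'a padic_int) \<noteq> 1"
  proof
    assume *: "(0 :: 'a padic_int) = 1"
    have "(0::int) = 1 mod int CARD('a) ^ 1"
      using * by transfer meson
    moreover have "int CARD('a) > 1"
      using prime_card[where 'a='a] prime_gt_1_nat by auto
    ultimately show False by simp
  qed
qed

end

lemma Rep_padic_int_mod:
  fixes x :: "'p::prime_card padic_int"
  assumes "m \<le> n"
  shows "Rep_padic_int x n mod int CARD('p) ^ m = Rep_padic_int x m"
  using assms
proof (induction n rule: dec_induct)
  case base
  show ?case using Rep_padic_int[of x] by auto
next
  case (step n)
  have "Rep_padic_int x (Suc n) mod int CARD('p) ^ m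
      = Rep_padic_int x (Suc n) mod int CARD('p) ^ n mod int CARD('p) ^ m"
    using step.hyps by (simp add: mod_mod_cancel le_imp_power_dvd)
  also have "\<dots> = Rep_padic_int x n mod int CARD('p) ^ m"
    using Rep_padic_int[of x] by auto
  finally show ?case using step.IH by simp
qed

lemma Rep_padic_int_0: "Rep_padic_int (x :: 'p::prime_card padic_int) 0 = 0"
  using Rep_padic_int_mod[of 0 0 x] by simp

text \<open>\<open>x\<close> is divisible by \<open>p\<^sup>n\<close> iff its residue modulo \<open>p\<^sup>n\<close> is 0, so the valuation of
  \<open>x \<noteq> 0\<close> is the least \<open>n\<close> such that the residue modulo \<open>p ^ Suc n\<close> is nonzero.\<close>

definition padic_int_val :: "'p::prime_card padic_int \<Rightarrow> nat" where
  "padic_int_val x = (LEAST n. Rep_padic_int x (Suc n) \<noteq> 0)"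

lemma Rep_padic_int_eq_0_iff:
  fixes x :: "'p::prime_card padic_int"
  assumes "x \<noteq> 0"
  shows "Rep_padic_int x n = 0 \<longleftrightarrow> n \<le> padic_int_val x"
proof -
  have z: "Rep_padic_int x 0 = 0" using Rep_padic_int_0 by auto
  have "\<exists>n. Rep_padic_int x n \<noteq> 0"
    using assms by transfer auto
  with z have ex: "\<exists>n. Rep_padic_int x (Suc n) \<noteq> 0"
    by (metis not0_implies_Suc)
  have nz: "Rep_padic_int x (Suc (padic_int_val x)) \<noteq> 0"
    unfolding padic_int_val_def by (rule LeastI_ex[OF ex])
  show ?thesis
  proof
    assume 0: "Rep_padic_int x n = 0"
    show "n \<le> padic_int_val x"
    proof (rule ccontr)
      assume "\<not> n \<le> padic_int_val x"
      then have "Rep_padic_int x n mod int CARD('p) ^ Suc (padic_int_val x) =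
        Rep_padic_int x (Suc (padic_int_val x))"
        by (intro Rep_padic_int_mod) simp
      with 0 nz show False by simp
    qed
  next
    assume *: "n \<le> padic_int_val x"
    show "Rep_padic_int x n = 0"
    proof (cases n)
      case 0 then show ?thesis using z by simp
    next
      case (Suc m)
      then have "m < padic_int_val x" using * by simp
      then show ?thesis
        unfolding padic_int_val_def Suc using not_less_Least by blast
    qed
  qed
qed

lemma padic_int_valI:
  fixes x :: "'p::prime_card padic_int"
  assumes "Rep_padic_int x n = 0" "Rep_padic_int x (Suc n) \<noteq> 0"
  shows "x \<noteq> 0" "padic_int_val x = n"
proof -
  show nz: "x \<noteq> 0" using assms(2) by (auto simp: zero_padic_int.rep_eq)
  show "padic_int_val x = n"
    using assms Rep_padic_int_eq_0_iff[OF nz] by (metis le_SucE le_antisym le_refl not_less_eq_eq)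
qed

lemma Rep_padic_int_factor:
  fixes x :: "'p::prime_card padic_int"
  assumes "x \<noteq> 0" "padic_int_val x < n"
  obtains u where "Rep_padic_int x n = int CARD('p) ^ padic_int_val x * u"
    "\<not> int CARD('p) dvd u"
proof -
  let ?v = "padic_int_val x" and ?p = "int CARD('p)"
  have "Rep_padic_int x n mod ?p ^ ?v = 0"
    using Rep_padic_int_mod[of ?v n x] Rep_padic_int_eq_0_iff[OF assms(1), of ?v] assms(2) by simp
  then obtain u where u: "Rep_padic_int x n = ?p ^ ?v * u" by (meson dvdE mod_eq_0_iff_dvd)
  have "Rep_padic_int x n mod ?p ^ Suc ?v \<noteq> 0"
    using Rep_padic_int_mod[of "Suc ?v" n x] Rep_padic_int_eq_0_iff[OF assms(1), of "Suc ?v"] assms(2)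
    by simp
  then have "\<not> ?p dvd u" unfolding u by (auto simp: mod_eq_0_iff_dvd mult_dvd_mono mult.commute)
  with u show thesis using that by blast
qed

lemma padic_int_val_mult:
  fixes x y :: "'p::prime_card padic_int"
  assumes "x \<noteq> 0" "y \<noteq> 0"
  shows "x * y \<noteq> 0" "padic_int_val (x * y) = padic_int_val x + padic_int_val y"
proof -
  let ?p = "int CARD('p)" and ?n = "padic_int_val x + padic_int_val y"
  have pr: "prime ?p" using prime_card[where 'a='p] by simp
  then have p0: "?p \<noteq> 0" by auto
  obtain u where u: "Rep_padic_int x (Suc ?n) = ?p ^ padic_int_val x * u" "\<not> ?p dvd u"
    by (rule Rep_padic_int_factor[OF assms(1), of "Suc ?n"]) auto
  obtain v where v: "Rep_padic_int y (Suc ?n) = ?p ^ padic_int_val y * v" "\<not> ?p dvd v"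
    by (rule Rep_padic_int_factor[OF assms(2), of "Suc ?n"]) auto
  have uv: "\<not> ?p dvd u * v" using u v pr by (simp add: prime_dvd_mult_iff)
  have r: "Rep_padic_int (x * y) (Suc ?n) = (?p ^ ?n * (u * v)) mod (?p ^ ?n * ?p)"
    by (simp add: times_padic_int.rep_eq u v power_add ac_simps)
  have "Rep_padic_int (x * y) (Suc ?n) \<noteq> 0"
    unfolding r using uv p0 by (simp add: mult_mod_right[symmetric] dvd_eq_mod_eq_0)
  moreover have "Rep_padic_int (x * y) ?n = 0"
    using Rep_padic_int_mod[of ?n "Suc ?n" "x * y"] unfolding r by (simp add: mod_mod_cancel)
  ultimately show "x * y \<noteq> 0" "padic_int_val (x * y) = ?n"
    using padic_int_valI by blast+
qed

lemma padic_int_val_add: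
  fixes x y :: "'p::prime_card padic_int"
  assumes "x \<noteq> 0" "y \<noteq> 0" "x + y \<noteq> 0"
  shows "min (padic_int_val x) (padic_int_val y) \<le> padic_int_val (x + y)"
proof -
  let ?m = "min (padic_int_val x) (padic_int_val y)"
  have "Rep_padic_int x ?m = 0" "Rep_padic_int y ?m = 0"
    using Rep_padic_int_eq_0_iff[OF assms(1)] Rep_padic_int_eq_0_iff[OF assms(2)] by auto
  then have "Rep_padic_int (x + y) ?m = 0"
    by (simp add: plus_padic_int.rep_eq)
  then show ?thesis using Rep_padic_int_eq_0_iff[OF assms(3)] by blast
qed

text \<open>The division operation is exact division where possible; it only serves to make the library's
  \<^const>\<open>coprime\<close> available on polynomials over the p-adic integers.\<close>

instantiation padic_int :: (prime_card) idom_divide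
begin

definition divide_padic_int :: "'a padic_int \<Rightarrow> 'a padic_int \<Rightarrow> 'a padic_int" where
  "divide_padic_int x y = (if y = 0 then 0 else if y dvd x then (SOME z. x = z * y) else 0)"

instance
proof
  fix a b :: "'a padic_int"
  show "a \<noteq> 0 \<Longrightarrow> b \<noteq> 0 \<Longrightarrow> a * b \<noteq> 0" by (rule padic_int_val_mult)
  show "a div 0 = 0" by (simp add: divide_padic_int_def)
  assume b: "b \<noteq> 0"
  have "a * b = (SOME z. a * b = z * b) * b" by (rule someI[where P = "\<lambda>z. a * b = z * b"]) simp
  then have "(a - (SOME z. a * b = z * b)) * b = 0" by (simp add: left_diff_distrib)
  then have "(SOME z. a * b = z * b) = a"
    using b padic_int_val_mult(1)[of "a - (SOME z. a * b = z * b)" b]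
    by (metis eq_iff_diff_eq_0)
  then show "a * b div b = a" using b by (simp add: divide_padic_int_def)
qed

end


section \<open>Fraction fields of domains with a non-Archimedean absolute value\<close>

text \<open>The library's \<^const>\<open>norm\<close> is only usable on real normed vector spaces, hence a separate
  constant for the absolute value.\<close>

class nonarch_idom = idom +
  fixes nabs :: "'a \<Rightarrow> real"
  assumes nabs_ge_0 [simp]: "0 \<le> nabs x"
    and nabs_eq_0 [simp]: "nabs x = 0 \<longleftrightarrow> x = 0"
    and nabs_mult: "nabs (x * y) = nabs x * nabs y"
    and nabs_add: "nabs (x + y) \<le> max (nabs x) (nabs y)"
begin

lemma nabs_one [simp]: "nabs 1 = 1"
  using nabs_mult[of 1 1] nabs_eq_0[of 1] by (simp del: nabs_eq_0)

lemma nabs_minus [simp]: "nabs (- x) = nabs x"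
proof -
  have "nabs (- x) * nabs (- x) = nabs x * nabs x"
    by (simp flip: nabs_mult)
  then show ?thesis
    using nabs_ge_0 by (metis abs_of_nonneg real_sqrt_abs2)
qed

lemma nabs_diff: "nabs (x - y) \<le> max (nabs x) (nabs y)"
  using nabs_add[of x "- y"] by simp

end

instantiation padic_int :: (prime_card) nonarch_idom
begin

definition nabs_padic_int :: "'a padic_int \<Rightarrow> real" where
  "nabs_padic_int x = (if x = 0 then 0 else inverse (real CARD('a)) ^ padic_int_val x)"

instance
proof
  fix x y :: "'a padic_int"
  have p1: "CARD('a) > 1" using prime_card[where 'a='a] prime_gt_1_nat by auto
  show "0 \<le> nabs x" "nabs x = 0 \<longleftrightarrow> x = 0"
    using p1 by (auto simp: nabs_padic_int_def)
  show "nabs (x * y) = nabs x * nabs y"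
    using padic_int_val_mult[of x y] by (auto simp: nabs_padic_int_def power_add)
  have anti: "inverse (real CARD('a)) ^ n \<le> inverse (real CARD('a)) ^ m" if "m \<le> n" for m n
    using that p1 by (intro power_decreasing) (auto simp: field_simps)
  show "nabs (x + y) \<le> max (nabs x) (nabs y)"
  proof (cases "x = 0 \<or> y = 0 \<or> x + y = 0")
    case True
    then show ?thesis using p1 by (auto simp: nabs_padic_int_def le_max_iff_disj)
  next
    case False
    then have "padic_int_val x \<le> padic_int_val (x + y) \<or> padic_int_val y \<le> padic_int_val (x + y)"
      using padic_int_val_add[of x y] by (auto simp: min_le_iff_disj)
    then show ?thesis using False anti by (auto simp: nabs_padic_int_def le_max_iff_disj)
  qed
qed

end

instantiation fract :: (nonarch_idom) nonarch_idom
begin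

definition nabs_fract :: "'a fract \<Rightarrow> real" where
  "nabs_fract x = (THE r. \<forall>a b. b \<noteq> 0 \<longrightarrow> x = Fract a b \<longrightarrow> r = nabs a / nabs b)"

lemma nabs_Fract:
  assumes "b \<noteq> 0"
  shows "nabs (Fract a b) = nabs a / nabs (b :: 'a)"
  unfolding nabs_fract_def
proof (rule the_equality)
  show "\<forall>c d. d \<noteq> 0 \<longrightarrow> Fract a b = Fract c d \<longrightarrow> nabs a / nabs b = nabs c / nabs d"
    using assms by (metis eq_fract(1) frac_eq_eq nabs_eq_0 nabs_mult)
qed (use assms in blast)

instance
proof
  fix x y :: "'a fract"
  obtain a b where x: "x = Fract a b" "b \<noteq> 0" by (cases x)
  obtain c d where y: "y = Fract c d" "d \<noteq> 0" by (cases y)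
  have b: "nabs b > 0" and d: "nabs d > 0"
    using x y by (metis nabs_eq_0 nabs_ge_0 order_less_le)+
  show "0 \<le> nabs x" by (simp add: x nabs_Fract)
  show "nabs x = 0 \<longleftrightarrow> x = 0"
    using x by (auto simp: nabs_Fract Zero_fract_def eq_fract)
  show "nabs (x * y) = nabs x * nabs y"
    by (simp add: x y nabs_Fract nabs_mult)
  have "nabs (x + y) = nabs (a * d + c * b) / (nabs b * nabs d)"
    using x y by (simp add: nabs_Fract nabs_mult)
  also have "\<dots> \<le> max (nabs a * nabs d) (nabs c * nabs b) / (nabs b * nabs d)"
    using nabs_add[of "a * d" "c * b"] b d
    by (intro divide_right_mono) (auto simp: nabs_mult)
  also have "\<dots> = max (nabs x) (nabs y)"
    using b d x y by (auto simp: nabs_Fract max_def field_simps)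
  finally show "nabs (x + y) \<le> max (nabs x) (nabs y)" .
qed

end

instantiation fract :: (nonarch_idom) metric_space
begin

definition dist_fract :: "'a fract \<Rightarrow> 'a fract \<Rightarrow> real" where
  "dist_fract x y = nabs (x - y)"

definition uniformity_fract :: "('a fract \<times> 'a fract) filter" where
  "uniformity_fract = (INF e\<in>{0<..}. principal {(x, y). dist x y < e})"

definition open_fract :: "'a fract set \<Rightarrow> bool" where
  "open_fract U = (\<forall>x\<in>U. \<forall>\<^sub>F (x', y) in uniformity. x' = x \<longrightarrow> y \<in> U)"

instance
proof
  fix x y z :: "'a fract"
  show "dist x y = 0 \<longleftrightarrow> x = y" by (simp add: dist_fract_def)
  have "nabs ((x - z) - (y - z)) \<le> max (nabs (x - z)) (nabs (y - z))" by (rule nabs_diff)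
  then show "dist x y \<le> dist x z + dist y z"
    using nabs_ge_0[of "x - z"] nabs_ge_0[of "y - z"]
    by (simp add: dist_fract_def max_def split: if_splits del: nabs_ge_0)
qed (simp_all only: uniformity_fract_def open_fract_def)

end


section \<open>The field of p-adic numbers\<close>

type_synonym 'p padic = "'p padic_int fract"

text \<open>The absolute value is normalised so that the prime has absolute value \<open>1/p\<close>.\<close>

lemma nabs_padic_prime: "nabs (of_nat CARD('p) :: 'p::prime_card padic) = 1 / real CARD('p)"
proof -
  let ?p = "CARD('p)"
  have p1: "?p > 1" using prime_card[where 'a='p] prime_gt_1_nat by auto
  have R: "Rep_padic_int (of_nat m :: 'p padic_int) n = int m mod int ?p ^ n" for m n
    by (induction m) (auto simp: zero_padic_int.rep_eq one_padic_int.rep_eq plus_padic_int.rep_eq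
        mod_simps)
  have "Rep_padic_int (of_nat ?p :: 'p padic_int) 1 = 0"
    "Rep_padic_int (of_nat ?p :: 'p padic_int) (Suc 1) \<noteq> 0"
    using p1 by (auto simp: R)
  note padic_int_valI[OF this]
  then have "nabs (of_nat ?p :: 'p padic_int) = 1 / real ?p"
    by (simp add: nabs_padic_int_def inverse_eq_divide)
  then show ?thesis by (simp add: of_nat_fract nabs_Fract)
qed

text \<open>\<open>padic_ball a k\<close> is the closed ball of radius \<open>p\<^sup>k\<close> around \<open>a\<close>.\<close>

definition padic_ball :: "'p::prime_card padic \<Rightarrow> int \<Rightarrow> 'p padic set" where
  "padic_ball a k = cball a (real CARD('p) powi k)"

text \<open>Haar measure, as a property of a measure on the Borel sets: the values on balls determine it
  uniquely.\<close>

definition padic_haar :: "'p::prime_card padic measure \<Rightarrow> bool" where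
  "padic_haar \<mu> \<longleftrightarrow> sets \<mu> = sets borel \<and>
     (\<forall>A\<in>sets borel. \<forall>c. emeasure \<mu> ((+) c ` A) = emeasure \<mu> A) \<and>
     (\<forall>a k. emeasure \<mu> (padic_ball a k) = ennreal (real CARD('p) powi k))"

text \<open>The library's \<^const>\<open>deriv\<close> requires a real normed field.\<close>

definition padic_deriv :: "('p::prime_card padic \<Rightarrow> 'p padic) \<Rightarrow> 'p padic \<Rightarrow> 'p padic" where
  "padic_deriv f a = Lim (at a) (\<lambda>x. (f x - f a) / (x - a))"


section \<open>Rational functions, local isometries and measure preservation\<close>

definition padic_rat_fun ::
  "'p::prime_card padic_int poly \<Rightarrow> 'p padic_int poly \<Rightarrow> 'p padic \<Rightarrow> 'p padic" where
  "padic_rat_fun P Q x = poly (fract_poly P) x / poly (fract_poly Q) x"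

definition rational_self_map ::
  "'p::prime_card padic set \<Rightarrow> 'p padic_int poly \<Rightarrow> 'p padic_int poly \<Rightarrow> bool" where
  "rational_self_map X P Q \<longleftrightarrow> coprime P Q \<and> (\<forall>x\<in>X. poly (fract_poly Q) x \<noteq> 0) \<and>
     padic_rat_fun P Q ` X \<subseteq> X"

definition local_isometry_on :: "'a::metric_space set \<Rightarrow> ('a \<Rightarrow> 'a) \<Rightarrow> bool" where
  "local_isometry_on X f \<longleftrightarrow>
     (\<forall>a\<in>X. \<exists>r>0. cball a r \<subseteq> X \<and> (\<forall>x\<in>cball a r. \<forall>y\<in>cball a r. dist (f x) (f y) = dist x y))"

definition measure_preserving_on :: "'a measure \<Rightarrow> 'a set \<Rightarrow> ('a \<Rightarrow> 'a) \<Rightarrow> bool" where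
  "measure_preserving_on \<mu> Y f \<longleftrightarrow>
     (\<forall>A\<in>sets \<mu>. A \<subseteq> Y \<longrightarrow>
       f -` A \<inter> Y \<in> sets \<mu> \<and> emeasure \<mu> (f -` A \<inter> Y) = emeasure \<mu> A)"

definition admissible_level :: "'p::prime_card padic set \<Rightarrow> ('p padic \<Rightarrow> 'p padic) \<Rightarrow> int \<Rightarrow> bool" where
  "admissible_level X f l \<longleftrightarrow>
     (\<forall>a\<in>X. padic_ball a l \<subseteq> X \<and>
       (\<forall>x\<in>padic_ball a l. \<forall>y\<in>padic_ball a l.
          nabs (f x - f y) = nabs (padic_deriv f a) * nabs (x - y)))"


section \<open>The digraphs of a rational function\<close>

text \<open>The balls of radius \<open>p\<^sup>t\<close> around points of \<open>X\<close> are pairwise disjoint, and they partition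
  \<open>X\<close> when \<open>t\<close> is at most an admissible level.  They serve as their own vertices.\<close>

definition ball_partition :: "'p::prime_card padic set \<Rightarrow> int \<Rightarrow> 'p padic set set" where
  "ball_partition X t = (\<lambda>a. padic_ball a t) ` X"

definition ball_digraph ::
  "'p::prime_card padic set \<Rightarrow> ('p padic \<Rightarrow> 'p padic) \<Rightarrow> int \<Rightarrow> 'p padic set pair_pre_digraph" where
  "ball_digraph X f t =
     \<lparr>pverts = ball_partition X t,
      parcs = {(D, E). D \<in> ball_partition X t \<and> E \<in> ball_partition X t \<and> f ` D \<subseteq> E}\<rparr>"

text \<open>\<open>rep t D\<close> is the chosen representative of the ball \<open>D\<close> of radius \<open>p\<^sup>t\<close>.\<close>

definition representatives ::
  "'p::prime_card padic set \<Rightarrow> int \<Rightarrow> (int \<Rightarrow> 'p padic set \<Rightarrow> 'p padic) \<Rightarrow> bool" where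
  "representatives X l rep \<longleftrightarrow>
     (\<forall>t\<le>l. (\<forall>D\<in>ball_partition X t. rep t D \<in> D) \<and>
       rep t ` ball_partition X t \<subseteq> rep (t - 1) ` ball_partition X (t - 1))"

text \<open>The polynomial \<open>P(p\<^sup>s x + a) - (p\<^sup>s y + b) Q(p\<^sup>s x + a)\<close>, as a polynomial in \<open>y\<close> whose
  coefficients are polynomials in \<open>x\<close>.\<close>

definition shifted_poly ::
  "'p::prime_card padic_int poly \<Rightarrow> 'p padic_int poly \<Rightarrow> 'p padic \<Rightarrow> 'p padic \<Rightarrow> nat \<Rightarrow> 'p padic poly poly"
  where
  "shifted_poly P Q a b s =
     (let q = of_nat CARD('p) ^ s;
          P' = pcompose (fract_poly P) [:a, q:];
          Q' = pcompose (fract_poly Q) [:a, q:]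
      in [:P':] - [:[:b:], [:q:]:] * [:Q':])"

definition shift_integral ::
  "'p::prime_card padic_int poly \<Rightarrow> 'p padic_int poly \<Rightarrow> 'p padic \<Rightarrow> 'p padic \<Rightarrow> nat \<Rightarrow> bool" where
  "shift_integral P Q a b s \<longleftrightarrow>
     (\<forall>i j. Polynomial.coeff (Polynomial.coeff (shifted_poly P Q a b s) i) j \<in> range to_fract)"

definition level_bound ::
  "'p::prime_card padic_int poly \<Rightarrow> 'p padic_int poly \<Rightarrow> int \<Rightarrow> 'p padic \<Rightarrow> nat \<Rightarrow> ereal" where
  "level_bound P Q l a s =
     (let p = real CARD('p);
          d = nabs (padic_deriv (padic_rat_fun P Q) a);
          q = nabs (poly (fract_poly Q) a);
          q' = nabs (poly (fract_poly (pderiv Q)) a)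
      in Min {ereal (p powi (- int s)),
              ereal (p powi l * d),
              if q' = 0 then \<infinity> else ereal (q * d / q'),
              ereal (p powi (- 2 * int s) * q * d\<^sup>2)})"

definition subsidiary_digraph ::
  "'p::prime_card padic set \<Rightarrow> 'p padic_int poly \<Rightarrow> 'p padic_int poly \<Rightarrow> int \<Rightarrow>
   (int \<Rightarrow> 'p padic set \<Rightarrow> 'p padic) \<Rightarrow> int \<Rightarrow> 'p padic set pair_pre_digraph" where
  "subsidiary_digraph X P Q l rep t =
     \<lparr>pverts = ball_partition X t,
      parcs = {(D, E). D \<in> ball_partition X t \<and> E \<in> ball_partition X t \<and>
        padic_rat_fun P Q ` D \<subseteq> E \<and>
        (\<exists>s. shift_integral P Q (rep t D) (rep t E) s \<and>
             (\<forall>s'<s. \<not> shift_integral P Q (rep t D) (rep t E) s') \<and>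
             ereal (real CARD('p) powi t) < level_bound P Q l (rep t D) s)}\<rparr>"

definition intrinsic_level ::
  "'p::prime_card padic set \<Rightarrow> 'p padic_int poly \<Rightarrow> 'p padic_int poly \<Rightarrow> int \<Rightarrow>
   (int \<Rightarrow> 'p padic set \<Rightarrow> 'p padic) \<Rightarrow> int \<Rightarrow> bool" where
  "intrinsic_level X P Q l rep t0 \<longleftrightarrow>
     (let level = (\<lambda>t. t \<le> l \<and>
        ball_digraph X (padic_rat_fun P Q) t = subsidiary_digraph X P Q l rep t)
      in level t0 \<and> (\<forall>t. level t \<longrightarrow> t \<le> t0))"

text \<open>A set \<open>C\<close> of cycles (given as arc lists) of a digraph on balls determines the union of the balls
  that occur as vertices on these cycles; every vertex of a cycle is the tail of one of its arcs.\<close>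

definition cycles_union :: "('a set \<times> 'a set) awalk set \<Rightarrow> 'a set" where
  "cycles_union C = \<Union> (\<Union>c\<in>C. fst ` set c)"

end

theory Submission
  imports Defs
begin

text \<open>
  On a ball of radius \<open>p\<^sup>l\<close> the map \<open>f\<close> scales distances by \<open>|f'|\<close>, and local isometry forces
  \<open>|f'| = 1\<close>; hence \<open>f\<close> is isometric on every ball of radius \<open>p\<^sup>t\<close>. Vertices have outdegree at
  most 1, so on a finite union of cycles \<open>f\<close> permutes the vertices, i.e. distinct balls of radius
  \<open>p\<^sup>t\<close> have images in distinct balls. For each \<open>k \<le> t\<close> it therefore induces an injective, hence
  bijective, map on the finitely many balls of radius \<open>p\<^sup>k\<close> in \<open>Y\<close>. Thus \<open>f(Y)\<close> is dense in
  \<open>Y\<close>, and compact, so it is all of \<open>Y\<close>; and preimages of balls are balls of the same radius, which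
  gives the invariance of the measure, since the small balls form a generating \<open>\<pi>\<close>-system.
\<close>

section \<open>Balls\<close>

lemma card_prime_gt_1: "1 < real CARD('p::prime_card)"
  using prime_card[where 'a='p] prime_gt_1_nat by auto

lemma radius_pos [simp]: "0 < real CARD('p::prime_card) powi k"
  by (simp add: zero_less_power_int)

lemma radius_mono: "j \<le> k \<Longrightarrow> real CARD('p::prime_card) powi j \<le> real CARD('p) powi k"
  using card_prime_gt_1[where 'p='p] by (intro power_int_increasing) auto

lemma ex_small_radius:
  assumes "0 < e"
  obtains k where "k \<le> t" "real CARD('p::prime_card) powi k < e"
proof -
  let ?p = "real CARD('p)"
  obtain n where n: "(1 / ?p) ^ n < e"
    using real_arch_pow_inv[OF assms, of "1 / ?p"] card_prime_gt_1[where 'p='p] by auto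
  have "?p powi (min t (- int n)) \<le> ?p powi (- int n)" by (rule radius_mono) simp
  also have "\<dots> = (1 / ?p) ^ n" by (simp add: power_int_minus power_one_over inverse_eq_divide)
  finally show thesis using n that[of "min t (- int n)"] by simp
qed

lemma padic_dist_ultrametric:
  fixes x y z :: "'p::prime_card padic"
  shows "dist x z \<le> max (dist x y) (dist y z)"
  using nabs_add[of "x - y" "y - z"] by (simp add: dist_fract_def)

lemma mem_padic_ball: "x \<in> padic_ball a k \<longleftrightarrow> dist a x \<le> real CARD('p) powi k"
  for a :: "'p::prime_card padic"
  by (simp add: padic_ball_def)

lemma centre_in_padic_ball [simp]: "a \<in> padic_ball a k"
  by (simp add: mem_padic_ball)

lemma dist_padic_ball_le:
  fixes a :: "'p::prime_card padic"
  assumes "x \<in> padic_ball a k" "y \<in> padic_ball a k"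
  shows "dist x y \<le> real CARD('p) powi k"
  using padic_dist_ultrametric[of x y a] assms by (simp add: mem_padic_ball dist_commute)

lemma padic_ball_subset:
  fixes a :: "'p::prime_card padic"
  assumes "b \<in> padic_ball a k" "j \<le> k"
  shows "padic_ball b j \<subseteq> padic_ball a k"
proof
  fix x assume "x \<in> padic_ball b j"
  then have "dist b x \<le> real CARD('p) powi k"
    using radius_mono[OF assms(2), where 'p='p] by (simp add: mem_padic_ball)
  then show "x \<in> padic_ball a k"
    using padic_dist_ultrametric[of a x b] assms(1) by (simp add: mem_padic_ball)
qed

lemma padic_ball_eq:
  fixes a :: "'p::prime_card padic"
  assumes "b \<in> padic_ball a k"
  shows "padic_ball b k = padic_ball a k"
proof -
  have "a \<in> padic_ball b k" using assms by (simp add: mem_padic_ball dist_commute)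
  then show ?thesis using assms padic_ball_subset by (metis order_refl subset_antisym)
qed

lemma closed_padic_ball: "closed (padic_ball a k)"
  by (simp add: padic_ball_def)

text \<open>By the ultrametric inequality every point of a ball is a centre of it, so the ball
  contains a ball of its own radius around each of its points.\<close>

lemma open_padic_ball: "open (padic_ball (a :: 'p::prime_card padic) k)"
  unfolding open_contains_cball
  using padic_ball_subset[of _ a k k] radius_pos[where 'p='p, of k] unfolding padic_ball_def by blast

lemma Union_ball_partition: "X \<subseteq> \<Union> (ball_partition X k)"
  using centre_in_padic_ball by (fastforce simp: ball_partition_def)

lemma ball_partition_eqI:
  assumes "D \<in> ball_partition X k" "x \<in> D"
  shows "D = padic_ball x k"
  using assms padic_ball_eq by (auto simp: ball_partition_def)

text \<open>The balls form an open cover of \<open>X\<close>; a ball whose centre lies in a member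
  of a finite subcover coincides with that member.\<close>

lemma finite_ball_partition:
  assumes "compact X"
  shows "finite (ball_partition X k)"
proof -
  have cover: "X \<subseteq> (\<Union>a\<in>X. padic_ball a k)"
    using Union_ball_partition by (simp add: ball_partition_def)
  obtain A where A: "A \<subseteq> X" "finite A" "X \<subseteq> (\<Union>a\<in>A. padic_ball a k)"
    by (rule compactE_image[OF assms open_padic_ball cover])
  have "ball_partition X k \<subseteq> (\<lambda>a. padic_ball a k) ` A"
  proof
    fix D assume "D \<in> ball_partition X k"
    then obtain x where x: "x \<in> X" "D = padic_ball x k" by (auto simp: ball_partition_def)
    with A obtain a where "a \<in> A" "x \<in> padic_ball a k" by auto
    then show "D \<in> (\<lambda>a. padic_ball a k) ` A" using x padic_ball_eq[of x a k] by simp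
  qed
  then show ?thesis using A(2) finite_surj by blast
qed

text \<open>No point is isolated: \<open>a + p^n\<close> works for large \<open>n\<close>. This
  supplies the nonzero distance that is cancelled when \<open>|f'(a)| = 1\<close> is
  derived.\<close>

lemma ex_padic_near:
  fixes a :: "'p::prime_card padic"
  assumes "0 < e"
  obtains x where "x \<noteq> a" "dist a x < e"
proof -
  let ?q = "of_nat CARD('p) :: 'p padic"
  obtain n where n: "(1 / real CARD('p)) ^ n < e"
    using real_arch_pow_inv[OF assms, of "1 / real CARD('p)"] card_prime_gt_1[where 'p='p] by auto
  have pow: "nabs (?q ^ n) = (1 / real CARD('p)) ^ n"
    by (induction n) (simp_all only: power.simps nabs_mult nabs_padic_prime nabs_one)
  then have "nabs (?q ^ n) \<noteq> 0" by simp
  then have "?q ^ n \<noteq> 0" by (metis nabs_eq_0)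
  moreover have "dist a (a + ?q ^ n) < e"
    using n pow by (simp add: dist_fract_def)
  ultimately show thesis using that[of "a + ?q ^ n"] by simp
qed

section \<open>The Borel sets of a compact union of balls\<close>

text \<open>Two balls are nested or disjoint, so an intersection is one of the two or empty; hence
  the empty set is added to the family.\<close>

lemma Int_stable_balls:
  fixes Y :: "'p::prime_card padic set"
  shows "Int_stable (insert {} (\<Union>k\<in>{..t}. ball_partition Y k))"
proof (rule Int_stableI)
  have *: "D \<inter> E = D \<or> D \<inter> E = {}"
    if "D = padic_ball a j" "E = padic_ball b k" "j \<le> k" for D E :: "'p padic set" and a b j k
  proof (cases "D \<inter> E = {}")
    case False
    then obtain x where "x \<in> D" "x \<in> E" by blast
    then have "D = padic_ball x j" "x \<in> padic_ball b k" using that padic_ball_eq by auto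
    then have "D \<subseteq> E" using padic_ball_subset that by blast
    then show ?thesis by blast
  qed simp
  fix D E
  assume "D \<in> insert {} (\<Union>k\<in>{..t}. ball_partition Y k)" "E \<in> insert {} (\<Union>k\<in>{..t}. ball_partition Y k)"
  then consider "D = {} \<or> E = {}"
    | a j b k where "D = padic_ball a j" "E = padic_ball b k"
    by (auto simp: ball_partition_def)
  then have "D \<inter> E \<in> {{}, D, E}"
  proof cases
    case 2
    then show ?thesis using *[of D a j E b k] *[of E b k D a j] by (cases "j \<le> k") (auto simp: Int_commute)
  qed auto
  then show "D \<inter> E \<in> insert {} (\<Union>k\<in>{..t}. ball_partition Y k)"
    using \<open>D \<in> _\<close> \<open>E \<in> _\<close> by auto
qed

text \<open>Compactness leaves finitely many balls for each radius, hence countably many in all, and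
  every relatively open subset of \<open>Y\<close> is the union of the balls of the family that it
  contains.\<close>

lemma sets_borel_eq_sigma_sets_balls:
  fixes Y :: "'p::prime_card padic set"
  assumes "compact Y" and balls: "\<And>x. x \<in> Y \<Longrightarrow> padic_ball x t \<subseteq> Y"
  shows "sets (restrict_space borel Y) = sigma_sets Y (insert {} (\<Union>k\<in>{..t}. ball_partition Y k))"
    (is "_ = sigma_sets Y ?E")
proof -
  have cnt: "countable (\<Union>k\<in>{..t}. ball_partition Y k)"
    using finite_ball_partition[OF assms(1)] by (intro countable_UN) (auto intro: countable_finite)
  have E_sub: "D \<subseteq> Y" if D: "D \<in> ?E" for D
  proof -
    have "padic_ball x k \<subseteq> Y" if "x \<in> Y" "k \<le> t" for x k
      using that balls padic_ball_subset[of x x t k] by fastforce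
    then show ?thesis using D by (auto simp: ball_partition_def)
  qed
  have Y: "Y \<in> sigma_sets UNIV {S. open S}"
    using borel_closed[OF compact_imp_closed[OF assms(1)]] by (simp add: borel_def)
  have "sets (restrict_space borel Y) = sigma_sets Y ((\<inter>) Y ` {S. open S})"
    using sigma_sets_Int[OF Y] by (simp add: sets_restrict_space borel_def)
  also have "\<dots> = sigma_sets Y ?E"
  proof (rule sigma_sets_eqI)
    fix A assume "A \<in> (\<inter>) Y ` {S. open S}"
    then obtain S where S: "A = Y \<inter> S" "open S" by auto
    let ?F = "{D \<in> (\<Union>k\<in>{..t}. ball_partition Y k). D \<subseteq> A}"
    have "A \<subseteq> \<Union> ?F"
    proof
      fix x assume x: "x \<in> A"
      then obtain e where e: "0 < e" "ball x e \<subseteq> S" using S by (auto simp: open_contains_ball)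
      obtain k where k: "k \<le> t" "real CARD('p) powi k < e" using ex_small_radius[OF e(1)] .
      have "padic_ball x k \<subseteq> S" using e k by (auto simp: mem_padic_ball)
      moreover have "padic_ball x k \<in> ball_partition Y k" using x S by (auto simp: ball_partition_def)
      ultimately have "padic_ball x k \<in> ?F" using k E_sub S by blast
      then show "x \<in> \<Union> ?F" using centre_in_padic_ball by blast
    qed
    then have "A = \<Union> ?F" by blast
    moreover have "\<Union> ?F \<in> sigma_sets Y ?E"
      using countable_subset[OF _ cnt, of ?F]
      by (intro sigma_sets_UNION) auto
    ultimately show "A \<in> sigma_sets Y ?E" by simp
  next
    fix D assume D: "D \<in> ?E"
    then have "open D" using open_padic_ball by (auto simp: ball_partition_def)
    moreover have "D = Y \<inter> D" using E_sub[OF D] by blast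
    ultimately show "D \<in> sigma_sets Y ((\<inter>) Y ` {S. open S})" by blast
  qed
  finally show ?thesis .
qed

section \<open>Maps that are isometric at a fixed scale\<close>

text \<open>All that the conclusion needs, freed from digraphs and rational functions. The second
  alternative in \<open>iso\<close> encodes that points in different balls of radius
  \<open>p^t\<close> have images in different balls.\<close>

locale scale_isometry =
  fixes Y :: "'p::prime_card padic set" and f :: "'p padic \<Rightarrow> 'p padic" and t :: int
  assumes cpt: "compact Y"
    and balls: "x \<in> Y \<Longrightarrow> padic_ball x t \<subseteq> Y"
    and into: "f ` Y \<subseteq> Y"
    and iso: "\<lbrakk>x \<in> Y; y \<in> Y; dist x y \<le> real CARD('p) powi t \<or> dist (f x) (f y) \<le> real CARD('p) powi t\<rbrakk>
      \<Longrightarrow> dist (f x) (f y) = dist x y"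
begin

lemma small_balls: "x \<in> Y \<Longrightarrow> k \<le> t \<Longrightarrow> padic_ball x k \<subseteq> Y"
  using balls padic_ball_subset[of x x t k] by fastforce

text \<open>Each direction uses one of the two alternatives of \<open>iso\<close>.\<close>

lemma image_in_ball_iff:
  assumes "x \<in> Y" "y \<in> Y" "k \<le> t"
  shows "f y \<in> padic_ball (f x) k \<longleftrightarrow> y \<in> padic_ball x k"
  using iso[OF assms(1,2)] radius_mono[OF assms(3), where 'p='p] by (auto simp: mem_padic_ball)

lemma inj: "inj_on f Y"
proof (rule inj_onI)
  fix x y assume *: "x \<in> Y" "y \<in> Y" "f x = f y"
  \<comment> \<open>Equal images are at distance 0, so the second alternative of \<open>iso\<close>
    applies.\<close>
  then have "dist (f x) (f y) = dist x y" by (intro iso) (auto simp: less_imp_le)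
  then show "x = y" using * by simp
qed

lemma locally_isometric: "local_isometry_on Y f"
  unfolding local_isometry_on_def
proof (intro ballI exI[of _ "real CARD('p) powi t"] conjI)
  fix a assume a: "a \<in> Y"
  then show sub: "cball a (real CARD('p) powi t) \<subseteq> Y" using balls by (simp add: padic_ball_def)
  fix x y assume "x \<in> cball a (real CARD('p) powi t)" "y \<in> cball a (real CARD('p) powi t)"
  then show "dist (f x) (f y) = dist x y"
    using sub dist_padic_ball_le[of x a t y] by (intro iso) (auto simp: padic_ball_def)
qed simp

lemma continuous: "continuous_on Y f"
  unfolding continuous_on_iff
proof (intro ballI allI impI)
  fix x e assume "x \<in> Y" "(0::real) < e"
  then show "\<exists>d>0. \<forall>x'\<in>Y. dist x' x < d \<longrightarrow> dist (f x') (f x) < e"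
    by (intro exI[of _ "min e (real CARD('p) powi t)"]) (auto simp: iso)
qed

text \<open>An injective self-map of the finite set of balls of radius \<open>p\<^sup>k\<close> is surjective.\<close>

lemma ball_meets_image:
  assumes "y \<in> Y" "k \<le> t"
  obtains x where "x \<in> Y" "f x \<in> padic_ball y k"
proof -
  let ?B = "ball_partition Y k"
  \<comment> \<open>\<open>g\<close> is the map induced on balls of radius \<open>p^k\<close>. The
    point chosen in \<open>D\<close> is immaterial, since \<open>f\<close> sends the points of one
    ball into one ball.\<close>
  define g where "g D = padic_ball (f (SOME x. x \<in> D)) k" for D
  have g: "g (padic_ball x k) = padic_ball (f x) k" if x: "x \<in> Y" for x
  proof -
    let ?z = "SOME z. z \<in> padic_ball x k"
    have z: "?z \<in> padic_ball x k" by (rule someI[of _ x]) simp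
    then have "?z \<in> Y" using small_balls[OF x assms(2)] by blast
    then show ?thesis
      using image_in_ball_iff[OF x _ assms(2)] z padic_ball_eq unfolding g_def by blast
  qed
  have "g ` ?B \<subseteq> ?B" using g into by (auto simp: ball_partition_def)
  moreover have "inj_on g ?B"
  proof (rule inj_onI)
    fix D E assume *: "D \<in> ?B" "E \<in> ?B" "g D = g E"
    then obtain x y where xy: "x \<in> Y" "y \<in> Y" "D = padic_ball x k" "E = padic_ball y k"
      by (auto simp: ball_partition_def)
    then have "f y \<in> padic_ball (f x) k" using * g centre_in_padic_ball by metis
    then show "D = E" using image_in_ball_iff[of x y k] xy assms(2) padic_ball_eq by blast
  qed
  ultimately have "g ` ?B = ?B" using finite_ball_partition[OF cpt] by (simp add: endo_inj_surj)
  then have "padic_ball y k \<in> g ` ?B" using assms by (auto simp: ball_partition_def)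
  then obtain x where "x \<in> Y" "padic_ball y k = padic_ball (f x) k"
    using g by (auto simp: ball_partition_def)
  then show thesis using that centre_in_padic_ball by metis
qed

lemma surj: "f ` Y = Y"
proof (intro equalityI into subsetI)
  fix y assume y: "y \<in> Y"
  have "closed (f ` Y)"
    using compact_continuous_image[OF continuous cpt] by (rule compact_imp_closed)
  moreover have "y \<in> closure (f ` Y)"
    unfolding closure_approachable
  proof (intro allI impI)
    fix e :: real assume "0 < e"
    then obtain k where k: "k \<le> t" "real CARD('p) powi k < e" by (rule ex_small_radius)
    obtain x where "x \<in> Y" "f x \<in> padic_ball y k" using ball_meets_image[OF y k(1)] .
    then show "\<exists>z\<in>f ` Y. dist z y < e" using k by (auto simp: mem_padic_ball dist_commute intro!: bexI[of _ x])
  qed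
  ultimately show "y \<in> f ` Y" by simp
qed

lemma vimage_ball:
  assumes "x \<in> Y" "k \<le> t"
  shows "f -` padic_ball (f x) k \<inter> Y = padic_ball x k"
  using image_in_ball_iff[OF assms(1) _ assms(2)] small_balls[OF assms] by blast

lemma measure_preserving:
  assumes "padic_haar \<mu>"
  shows "measure_preserving_on \<mu> Y f"
proof -
  let ?E = "insert {} (\<Union>k\<in>{..t}. ball_partition Y k)"
  let ?M = "restrict_space \<mu> Y"
  \<comment> \<open>Invariance becomes the equality of the restricted measure with its image under
    \<open>f\<close>.\<close>
  let ?N = "distr ?M ?M f"
  have sets: "sets \<mu> = sets borel"
    and haar: "\<And>a k. emeasure \<mu> (padic_ball a k) = ennreal (real CARD('p) powi k)"
    using assms by (auto simp: padic_haar_def)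
  have Y: "Y \<in> sets \<mu>" using cpt sets by (simp add: compact_imp_closed)
  have space: "space \<mu> = UNIV" using sets_eq_imp_space_eq[OF sets] by simp
  have sets_M: "sets ?M = sets (restrict_space borel Y)"
    by (simp add: sets sets_restrict_space)
  have sigma: "sets ?M = sigma_sets Y ?E"
    unfolding sets_M by (rule sets_borel_eq_sigma_sets_balls[OF cpt balls])
  have "f \<in> measurable (restrict_space borel Y) (restrict_space borel Y)"
    using borel_measurable_continuous_on_restrict[OF continuous] into
    by (intro measurable_restrict_space2) (auto simp: space_restrict_space)
  then have f: "f \<in> measurable ?M ?M"
    using measurable_cong_sets[OF sets_M sets_M] by simp
  have E_sub: "?E \<subseteq> Pow Y" using small_balls by (auto simp: ball_partition_def)
  \<comment> \<open>Both measures need only be compared on the generating balls; the finitely many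
    balls of radius \<open>p^t\<close> cover \<open>Y\<close> and have finite measure.\<close>
  have "?M = ?N"
  proof (rule measure_eqI_generator_eq_countable[where \<Omega> = Y and E = ?E and A = "ball_partition Y t"])
    show "Int_stable ?E" by (rule Int_stable_balls)
    show "?E \<subseteq> Pow Y" by (rule E_sub)
    show "sets ?M = sigma_sets Y ?E" "sets ?N = sigma_sets Y ?E" using sigma by simp_all
    show "ball_partition Y t \<subseteq> ?E" by auto
    show "\<Union> (ball_partition Y t) = Y"
      using Union_ball_partition balls by (fastforce simp: ball_partition_def)
    show "countable (ball_partition Y t)"
      using finite_ball_partition[OF cpt] by (rule countable_finite)
    show "emeasure ?M D \<noteq> \<infinity>" if "D \<in> ball_partition Y t" for D
      using that balls Y haar by (auto simp: ball_partition_def emeasure_restrict_space space)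
    show "emeasure ?M D = emeasure ?N D" if D: "D \<in> ?E" for D
    proof (cases "D = {}")
      case False
      then obtain y k where y: "y \<in> Y" "k \<le> t" "D = padic_ball y k"
        using D by (auto simp: ball_partition_def)
      \<comment> \<open>Surjectivity puts the centre in the image, so the preimage of
        \<open>D\<close> is a ball of the same radius and hence of the same measure.\<close>
      then obtain x where x: "x \<in> Y" "y = f x" using surj by blast
      have DM: "D \<in> sets ?M" using D sigma by auto
      have "emeasure ?N D = emeasure ?M (f -` D \<inter> Y)"
        using emeasure_distr[OF f DM] by (simp add: space_restrict_space space)
      also have "\<dots> = emeasure ?M (padic_ball x k)" using vimage_ball x y by simp
      also have "\<dots> = emeasure ?M D"
        using small_balls x y haar Y by (simp add: emeasure_restrict_space space)
      finally show ?thesis by simp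
    qed simp
  qed
  then have N: "emeasure ?M A = emeasure ?N A" for A by simp
  show ?thesis
    unfolding measure_preserving_on_def
  proof (intro ballI impI conjI)
    fix A assume A: "A \<in> sets \<mu>" "A \<subseteq> Y"
    then have AM: "A \<in> sets ?M" using Y by (auto simp: sets_restrict_space_iff space)
    have vM: "f -` A \<inter> Y \<in> sets ?M"
      using measurable_sets[OF f AM] by (simp add: space_restrict_space space)
    then show "f -` A \<inter> Y \<in> sets \<mu>" using Y by (auto simp: sets_restrict_space_iff space)
    have "emeasure \<mu> (f -` A \<inter> Y) = emeasure ?M (f -` A \<inter> Y)"
      using Y by (simp add: emeasure_restrict_space space)
    also have "\<dots> = emeasure ?N A"
      using emeasure_distr[OF f AM] by (simp add: space_restrict_space space)
    also have "\<dots> = emeasure \<mu> A"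
      unfolding N[symmetric] using A Y by (simp add: emeasure_restrict_space space)
    finally show "emeasure \<mu> (f -` A \<inter> Y) = emeasure \<mu> A" .
  qed
qed

end

section \<open>Cycles\<close>

text \<open>Both sides are the set of vertices visited by the walk. On a nonempty closed walk
  \<open>u = v\<close>, and the second part makes both insertions redundant.\<close>

lemma (in pre_digraph) cas_endpoints:
  assumes "cas u c v"
  shows "insert v (tail G ` set c) = insert u (head G ` set c)"
    and "c \<noteq> [] \<Longrightarrow> u \<in> tail G ` set c \<and> v \<in> head G ` set c"
  using assms by (induction c arbitrary: u) fastforce+

lemma (in pre_digraph) cycle_tails_eq_heads:
  assumes "cycle c"
  shows "tail G ` set c = head G ` set c" "set c \<subseteq> arcs G"
proof -
  obtain u where "awalk u c u" "c \<noteq> []" using assms by (auto simp: cycle_def)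
  then show "tail G ` set c = head G ` set c" "set c \<subseteq> arcs G"
    using cas_endpoints[of u c u] by (auto simp: awalk_def insert_absorb)
qed

section \<open>Isometry at an admissible level, and its use on unions of cycles\<close>

text \<open>The radius given by local isometry may be smaller than \<open>p^l\<close>. A point
  \<open>z \<noteq> a\<close> within both radii forces the scaling factor \<open>|f'(a)|\<close> to
  be 1, and this factor governs the whole ball of radius \<open>p^l\<close>.\<close>

lemma isometric_on_admissible_balls:
  fixes f :: "'p::prime_card padic \<Rightarrow> 'p padic"
  assumes "local_isometry_on X f" "admissible_level X f l" "a \<in> X"
    and xy: "x \<in> padic_ball a l" "y \<in> padic_ball a l"
  shows "dist (f x) (f y) = dist x y"
proof -
  obtain r where r: "r > 0" "\<And>x y. x \<in> cball a r \<Longrightarrow> y \<in> cball a r \<Longrightarrow> dist (f x) (f y) = dist x y"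
    using assms(1,3) unfolding local_isometry_on_def by metis
  have adm: "nabs (f x - f y) = nabs (padic_deriv f a) * nabs (x - y)"
    if "x \<in> padic_ball a l" "y \<in> padic_ball a l" for x y
    using assms(2,3) that unfolding admissible_level_def by blast
  have "0 < min r (real CARD('p) powi l)" using r by simp
  then obtain z where z: "z \<noteq> a" "dist a z < min r (real CARD('p) powi l)"
    by (rule ex_padic_near)
  have "nabs (padic_deriv f a) * nabs (a - z) = nabs (a - z)"
    using adm[of a z] r(2)[of a z] r(1) z by (simp add: mem_padic_ball dist_fract_def)
  then have "nabs (padic_deriv f a) = 1" using z by simp
  then show ?thesis using adm[OF xy] by (simp add: dist_fract_def)
qed

lemma scale_isometry_cycles_union:
  fixes X :: "'p::prime_card padic set"
  assumes "compact X" and isom: "local_isometry_on X f" and adm: "admissible_level X f l" and "t \<le> l"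
    and cyc: "\<forall>c\<in>C. pre_digraph.cycle (with_proj (ball_digraph X f t)) c"
  shows "scale_isometry (cycles_union C) f t"
proof -
  define A where "A = (\<Union>c\<in>C. set c)"
  have Y: "cycles_union C = \<Union> (fst ` A)" unfolding cycles_union_def A_def by blast
  have c: "fst ` set c = snd ` set c" "set c \<subseteq> parcs (ball_digraph X f t)" if "c \<in> C" for c
    using pre_digraph.cycle_tails_eq_heads[of "with_proj (ball_digraph X f t)" c] cyc that by simp_all
  have heads: "snd ` A = fst ` A" unfolding A_def using c(1) by (simp add: image_UN)
  have arc: "D \<in> ball_partition X t" "E \<in> ball_partition X t" "f ` D \<subseteq> E" if "(D, E) \<in> A" for D E
    using that c(2) unfolding A_def ball_digraph_def by auto
  \<comment> \<open>\<open>C\<close> may be infinite, but all arcs run between finitely many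
    balls.\<close>
  have fin: "finite A"
    using finite_ball_partition[OF assms(1), of t] arc(1,2)
    by (intro finite_subset[of A "ball_partition X t \<times> ball_partition X t"]) auto
  \<comment> \<open>Outdegree at most 1: the image of a point of \<open>D\<close> lies in only one
    ball of radius \<open>p^t\<close>.\<close>
  have "inj_on fst A"
  proof (rule inj_onI, clarsimp)
    fix D E E' assume *: "(D, E) \<in> A" "(D, E') \<in> A"
    then obtain a where "D = padic_ball a t" using arc(1) by (auto simp: ball_partition_def)
    then obtain x where "x \<in> D" using centre_in_padic_ball by blast
    then have "f x \<in> E" "f x \<in> E'" using arc(3) * by blast+
    then have "E = padic_ball (f x) t" "E' = padic_ball (f x) t"
      using arc(2) * ball_partition_eqI by blast+
    then show "E = E'" by simp
  qed
  \<comment> \<open>Counting: \<open>A\<close> has as many elements as its set of tails, which is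
    its set of heads, so no two arcs share a head.\<close>
  then have snd_inj: "inj_on snd A"
    using fin heads by (metis card_image eq_card_imp_inj_on)
  have vert: "D \<in> ball_partition X t" if "D \<in> fst ` A" for D using that arc(1) by force
  have ball: "padic_ball x t \<in> fst ` A" if "x \<in> cycles_union C" for x
    using that vert ball_partition_eqI unfolding Y by blast
  have arcf: "(padic_ball x t, padic_ball (f x) t) \<in> A" if x: "x \<in> cycles_union C" for x
  proof -
    obtain E where E: "(padic_ball x t, E) \<in> A" using ball[OF x] by force
    then have "f x \<in> E" using arc(3) centre_in_padic_ball by blast
    then show ?thesis using E arc(2) ball_partition_eqI by blast
  qed
  have sub: "D \<subseteq> X" if D: "D \<in> ball_partition X t" for D
  proof -
    obtain a where a: "a \<in> X" "D = padic_ball a t" using D by (auto simp: ball_partition_def)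
    then have "padic_ball a l \<subseteq> X" using adm by (simp add: admissible_level_def)
    then show ?thesis using a padic_ball_subset[of a a l t] \<open>t \<le> l\<close> by fastforce
  qed
  have YX: "cycles_union C \<subseteq> X" unfolding Y using vert sub by blast
  show ?thesis
  proof
    have "closed D" if "D \<in> fst ` A" for D
      using vert[OF that] closed_padic_ball by (auto simp: ball_partition_def)
    then have "closed (cycles_union C)"
      unfolding Y using fin by (intro closed_Union) auto
    then show "compact (cycles_union C)"
      using compact_Int_closed[OF assms(1), of "cycles_union C"] YX by (simp add: Int_absorb1)
    show "padic_ball x t \<subseteq> cycles_union C" if "x \<in> cycles_union C" for x
      using ball[OF that] unfolding Y by blast
    show "f ` cycles_union C \<subseteq> cycles_union C"
    proof
      fix y assume "y \<in> f ` cycles_union C"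
      then have "padic_ball y t \<in> snd ` A" using arcf by force
      then show "y \<in> cycles_union C" unfolding heads Y using centre_in_padic_ball by blast
    qed
    fix x y assume xy: "x \<in> cycles_union C" "y \<in> cycles_union C"
      and "dist x y \<le> real CARD('p) powi t \<or> dist (f x) (f y) \<le> real CARD('p) powi t"
    then have "y \<in> padic_ball x t"
    proof (elim disjE)
      assume "dist (f x) (f y) \<le> real CARD('p) powi t"
      then have "padic_ball (f y) t = padic_ball (f x) t"
        by (intro padic_ball_eq) (simp add: mem_padic_ball)
      \<comment> \<open>The arcs leaving the balls of \<open>x\<close> and \<open>y\<close> have the
        same head, so they are one arc and their tails agree.\<close>
      then have "padic_ball x t = padic_ball y t"
        using inj_onD[OF snd_inj _ arcf[OF xy(1)] arcf[OF xy(2)]] by simp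
      then show ?thesis by simp
    qed (simp add: mem_padic_ball)
    then show "dist (f x) (f y) = dist x y"
      using isometric_on_admissible_balls[OF isom adm, of x x y] xy YX radius_mono[OF \<open>t \<le> l\<close>, where 'p='p]
      by (auto simp: mem_padic_ball)
  qed
qed

theorem proposition4p7:
  fixes X :: "'p::prime_card padic set"
    and P Q :: "'p padic_int poly"
    and f :: "'p padic \<Rightarrow> 'p padic"
    and l t0 t :: int
    and rep :: "int \<Rightarrow> 'p padic set \<Rightarrow> 'p padic"
    and C :: "('p padic set \<times> 'p padic set) awalk set"
    and Y :: "'p padic set"
  assumes "compact X" and "open X"
    and "rational_self_map X P Q"
    and f: "f = padic_rat_fun P Q"
    and "local_isometry_on X f"
    and "admissible_level X f l"
    and "representatives X l rep"
    and "intrinsic_level X P Q l rep t0"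
    and "t \<le> t0"
    and "\<forall>c\<in>C. pre_digraph.cycle (with_proj (ball_digraph X f t)) c"
    and Y: "Y = cycles_union C"
  shows "f ` Y \<subseteq> Y \<and> bij_betw f Y Y \<and> local_isometry_on Y f \<and>
    (\<forall>\<mu>. padic_haar \<mu> \<longrightarrow> measure_preserving_on \<mu> Y f)"
proof -
  \<comment> \<open>The intrinsic level is by definition at most \<open>l\<close>.\<close>
  have "t \<le> l" using assms(8,9) by (auto simp: intrinsic_level_def Let_def)
  then interpret scale_isometry Y f t
    unfolding Y by (rule scale_isometry_cycles_union[OF assms(1,5,6) _ assms(10)])
  show ?thesis
    using into inj surj locally_isometric measure_preserving by (auto simp: bij_betw_def)
qed

end
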